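(* Let $n$ be a positive integer and let $G$ be the finite cyclic group of order $n$. Then the reduced power graph $R(G)$ is isomorphic to the divisor graph $D(n)$.
   Context: All graphs are finite, simple and undirected. The power graph $Pow(G)$ of a group $G$ is the graph with vertex set $G$ in which two distinct vertices $x,y$ are adjacent if $x=y^m$ or $y=x^m$ for some positive integer $m$. Define an equivalence relation on $G$ by $x\sim y$ if and only if $\langle x\rangle=\langle y\rangle$, and write $[x]$ for the class of $x$. The reduced power graph $R(G)$ has as vertices the equivalence classes of $\sim$; two distinct classes $[x],[y]$ are adjacent if and only if $\{x,y\}$ is an edge of $Pow(G)$ (this does not depend on the choice of representatives). The divisor graph $D(n)$ has as vertex set the set of positive divisors of $n$; two distinct vertices $a,b$ are adjacent if and only if $a\mid b$ or $b\mid a$. *)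

theory Defs
  imports "HOL-Algebra.Elementary_Groups" "HOL-Algebra.Multiplicative_Group" "Graph_Theory.Graph_Theory"
begin

text \<open>
  Finite simple undirected graphs are rendered by the locale \<^locale>\<open>pair_graph\<close>: the arc set is a
  finite, irreflexive, symmetric relation, and an edge \<open>{x, y}\<close> corresponds to the two arcs \<open>(x, y)\<close>
  and \<open>(y, x)\<close>.  For such graphs \<^const>\<open>digraph_iso\<close> (applied through \<^const>\<open>with_proj\<close>) is the usual
  isomorphism of simple graphs, see \<open>digraph_iso_with_proj_iff\<close> below.
\<close>

definition power_graph :: "('a, 'b) monoid_scheme \<Rightarrow> 'a pair_pre_digraph" where
  "power_graph G =
    \<lparr> pverts = carrier G,
      parcs = {(x, y). x \<in> carrier G \<and> y \<in> carrier G \<and> x \<noteq> y \<and>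
                 (\<exists>m::nat. 0 < m \<and> (x = y [^]\<^bsub>G\<^esub> m \<or> y = x [^]\<^bsub>G\<^esub> m))} \<rparr>"

definition same_generated :: "('a, 'b) monoid_scheme \<Rightarrow> ('a \<times> 'a) set" where
  "same_generated G =
    {(x, y). x \<in> carrier G \<and> y \<in> carrier G \<and> generate G {x} = generate G {y}}"

text \<open>
  Adjacency of classes is stated for some pair of representatives; for finite groups this is the
  same as for all pairs, see \<open>reduced_power_graph_arc_iff\<close> below.
\<close>

definition reduced_power_graph :: "('a, 'b) monoid_scheme \<Rightarrow> 'a set pair_pre_digraph" where
  "reduced_power_graph G =
    \<lparr> pverts = carrier G // same_generated G,
      parcs = {(A, B). A \<in> carrier G // same_generated G \<and> B \<in> carrier G // same_generated G \<and>
                 A \<noteq> B \<and> (\<exists>x\<in>A. \<exists>y\<in>B. (x, y) \<in> parcs (power_graph G))} \<rparr>"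

definition divisor_graph :: "nat \<Rightarrow> nat pair_pre_digraph" where
  "divisor_graph n =
    \<lparr> pverts = {d. 0 < d \<and> d dvd n},
      parcs = {(a, b). 0 < a \<and> a dvd n \<and> 0 < b \<and> b dvd n \<and> a \<noteq> b \<and> (a dvd b \<or> b dvd a)} \<rparr>"

lemma equiv_same_generated: "equiv (carrier G) (same_generated G)"
  by (auto simp: equiv_def refl_on_def sym_on_def trans_on_def same_generated_def)

lemma pair_graph_power_graph:
  assumes "finite (carrier G)"
  shows "pair_graph (power_graph G)"
proof -
  have "finite (parcs (power_graph G))"
    by (rule finite_subset[of _ "carrier G \<times> carrier G"]) (use assms in \<open>auto simp: power_graph_def\<close>)
  then show ?thesis
    using assms
    by unfold_locales (auto simp: power_graph_def symmetric_def sym_on_def)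
qed

lemma pair_graph_reduced_power_graph:
  assumes "finite (carrier G)"
  shows "pair_graph (reduced_power_graph G)"
proof -
  have fin: "finite (carrier G // same_generated G)"
    using assms by (intro finite_quotient) (auto simp: same_generated_def)
  have "finite (parcs (reduced_power_graph G))"
    by (rule finite_subset[of _ "(carrier G // same_generated G) \<times> (carrier G // same_generated G)"])
      (use fin in \<open>auto simp: reduced_power_graph_def\<close>)
  moreover have "sym (parcs (reduced_power_graph G))"
  proof (rule symI)
    fix A B assume "(A, B) \<in> parcs (reduced_power_graph G)"
    moreover have "(y, x) \<in> parcs (power_graph G)" if "(x, y) \<in> parcs (power_graph G)" for x y
      using that by (auto simp: power_graph_def)
    ultimately show "(B, A) \<in> parcs (reduced_power_graph G)"
      unfolding reduced_power_graph_def by auto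
  qed
  then have "symmetric (with_proj (reduced_power_graph G))"
    by (simp add: symmetric_def)
  ultimately show ?thesis
    using fin by unfold_locales (auto simp: reduced_power_graph_def)
qed

lemma pair_graph_divisor_graph:
  assumes "0 < n"
  shows "pair_graph (divisor_graph n)"
proof -
  have fin: "finite {d. d dvd n}" using assms by simp
  have "finite (parcs (divisor_graph n))"
    by (rule finite_subset[of _ "{d. d dvd n} \<times> {d. d dvd n}"])
      (use fin in \<open>auto simp: divisor_graph_def\<close>)
  then show ?thesis
    using fin
    by unfold_locales (auto simp: divisor_graph_def symmetric_def sym_on_def)
qed

lemma (in group) generate_singleton_eq_pow:
  assumes "finite (carrier G)" "x \<in> carrier G"
  shows "y \<in> generate G {x} \<longleftrightarrow> (\<exists>m::nat. 0 < m \<and> y = x [^] m)"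
proof -
  have gen: "generate G {x} = {x [^] k |k. k \<in> (UNIV :: nat set)}"
    using assms by (rule generate_pow_on_finite_carrier)
  have pos: "0 < ord x"
    using ord_ge_1[OF assms] by simp
  have "\<exists>m::nat. 0 < m \<and> x [^] k = x [^] m" for k :: nat
  proof (intro exI conjI)
    show "0 < k + ord x" using pos by simp
    show "x [^] k = x [^] (k + ord x)"
      using assms(2) by (simp add: nat_pow_mult[symmetric])
  qed
  then show ?thesis
    unfolding gen by blast
qed

lemma (in group) generate_singleton_mono_iff:
  assumes "x \<in> carrier G" "y \<in> carrier G"
  shows "y \<in> generate G {x} \<longleftrightarrow> generate G {y} \<subseteq> generate G {x}"
  using assms generate_subgroup_incl[of "{y}" "generate G {x}"] generate_is_subgroup[of "{x}"]
    generate.incl[of y "{y}" G] by auto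

lemma (in group) reduced_power_graph_arc_iff:
  assumes fin: "finite (carrier G)" and x: "x \<in> carrier G" and y: "y \<in> carrier G"
    and ne: "same_generated G `` {x} \<noteq> same_generated G `` {y}"
  shows "(same_generated G `` {x}, same_generated G `` {y}) \<in> parcs (reduced_power_graph G)
    \<longleftrightarrow> (x, y) \<in> parcs (power_graph G)"
proof -
  have arc: "(u, v) \<in> parcs (power_graph G) \<longleftrightarrow> u \<noteq> v \<and>
      (generate G {u} \<subseteq> generate G {v} \<or> generate G {v} \<subseteq> generate G {u})"
    if u: "u \<in> carrier G" and v: "v \<in> carrier G" for u v
  proof -
    have "(u, v) \<in> parcs (power_graph G) \<longleftrightarrow> u \<noteq> v \<and>
        ((\<exists>m::nat. 0 < m \<and> u = v [^] m) \<or> (\<exists>m::nat. 0 < m \<and> v = u [^] m))"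
      using u v by (auto simp: power_graph_def)
    then show ?thesis
      by (simp only: generate_singleton_eq_pow[OF fin u, symmetric]
          generate_singleton_eq_pow[OF fin v, symmetric]
          generate_singleton_mono_iff[OF u v] generate_singleton_mono_iff[OF v u])
  qed
  have cls: "u \<in> carrier G \<and> generate G {u} = generate G {z}"
    if "u \<in> same_generated G `` {z}" for u z
    using that by (auto simp: same_generated_def)
  have self: "z \<in> same_generated G `` {z}" if "z \<in> carrier G" for z
    using that by (auto simp: same_generated_def)
  have quo: "same_generated G `` {z} \<in> carrier G // same_generated G" if "z \<in> carrier G" for z
    using that by (rule quotientI)
  have "x \<noteq> y" using ne by blast
  show ?thesis
  proof
    assume "(same_generated G `` {x}, same_generated G `` {y}) \<in> parcs (reduced_power_graph G)"
    then obtain u v where u: "u \<in> same_generated G `` {x}" and v: "v \<in> same_generated G `` {y}"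
      and uv: "(u, v) \<in> parcs (power_graph G)"
      by (auto simp: reduced_power_graph_def)
    then show "(x, y) \<in> parcs (power_graph G)"
      using cls[OF u] cls[OF v] arc[of u v] arc[OF x y] \<open>x \<noteq> y\<close> by simp
  next
    assume "(x, y) \<in> parcs (power_graph G)"
    then show "(same_generated G `` {x}, same_generated G `` {y}) \<in> parcs (reduced_power_graph G)"
      using self[OF x] self[OF y] quo[OF x] quo[OF y] ne
      unfolding reduced_power_graph_def pair_pre_digraph.simps mem_Collect_eq prod.case by blast
  qed
qed

lemma digraph_iso_with_proj_iff:
  assumes "pair_wf_digraph G" "pair_wf_digraph H"
  shows "digraph_iso (with_proj G) (with_proj H) \<longleftrightarrow>
    (\<exists>f. bij_betw f (pverts G) (pverts H) \<and>
      (\<forall>u\<in>pverts G. \<forall>v\<in>pverts G. (u, v) \<in> parcs G \<longleftrightarrow> (f u, f v) \<in> parcs H))"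
proof
  assume "digraph_iso (with_proj G) (with_proj H)"
  then obtain h where h: "pre_digraph.digraph_isomorphism (with_proj G) h"
    and H: "with_proj H = app_iso h (with_proj G)"
    unfolding digraph_iso_def by blast
  let ?f = "iso_verts h"
  have vH: "pverts H = ?f ` pverts G" and aH: "parcs H = iso_arcs h ` parcs G"
    and tH: "iso_tail h = fst" and hH: "iso_head h = snd"
    using H by (auto simp: app_iso_def with_proj_def)
  have inj: "inj_on ?f (pverts G)"
    and arcs: "\<forall>a\<in>parcs G. iso_arcs h a = (?f (fst a), ?f (snd a))"
    using h tH hH by (auto simp: pre_digraph.digraph_isomorphism_def prod_eq_iff)
  have "(u, v) \<in> parcs G \<longleftrightarrow> (?f u, ?f v) \<in> parcs H" if u: "u \<in> pverts G" and v: "v \<in> pverts G" for u v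
  proof
    assume "(u, v) \<in> parcs G"
    then show "(?f u, ?f v) \<in> parcs H" using aH arcs by force
  next
    assume "(?f u, ?f v) \<in> parcs H"
    then obtain a where a: "a \<in> parcs G" "?f u = ?f (fst a)" "?f v = ?f (snd a)"
      using aH arcs by auto
    have "fst a \<in> pverts G" "snd a \<in> pverts G"
      using a(1) assms(1) by (simp_all add: pair_wf_digraph.arc_fst_in_verts pair_wf_digraph.arc_snd_in_verts)
    then have "u = fst a" "v = snd a" using a u v inj by (auto dest: inj_onD)
    then show "(u, v) \<in> parcs G" using a(1) by simp
  qed
  then show "\<exists>f. bij_betw f (pverts G) (pverts H) \<and>
      (\<forall>u\<in>pverts G. \<forall>v\<in>pverts G. (u, v) \<in> parcs G \<longleftrightarrow> (f u, f v) \<in> parcs H)"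
    using inj vH by (intro exI[of _ ?f]) (auto simp: bij_betw_def)
next
  assume "\<exists>f. bij_betw f (pverts G) (pverts H) \<and>
      (\<forall>u\<in>pverts G. \<forall>v\<in>pverts G. (u, v) \<in> parcs G \<longleftrightarrow> (f u, f v) \<in> parcs H)"
  then obtain f where bij: "bij_betw f (pverts G) (pverts H)"
    and arc: "\<And>u v. u \<in> pverts G \<Longrightarrow> v \<in> pverts G \<Longrightarrow> (u, v) \<in> parcs G \<longleftrightarrow> (f u, f v) \<in> parcs H"
    by blast
  define h where "h = \<lparr> iso_verts = f, iso_arcs = map_prod f f,
    iso_head = (snd :: 'b \<times> 'b \<Rightarrow> 'b), iso_tail = (fst :: 'b \<times> 'b \<Rightarrow> 'b) \<rparr>"
  interpret G: pair_wf_digraph G by (rule assms(1))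
  interpret H: pair_wf_digraph H by (rule assms(2))
  have inj: "inj_on f (pverts G)" and img: "f ` pverts G = pverts H"
    using bij by (auto simp: bij_betw_def)
  have sub: "parcs G \<subseteq> pverts G \<times> pverts G"
    using G.wellformed' by auto
  have inj2: "inj_on (map_prod f f) (parcs G)"
    using map_prod_inj_on[OF inj inj] sub by (rule inj_on_subset)
  have "parcs H \<subseteq> map_prod f f ` parcs G"
  proof clarify
    fix a b assume ab: "(a, b) \<in> parcs H"
    then have "a \<in> f ` pverts G" "b \<in> f ` pverts G" using H.wellformed' img by auto
    then obtain u v where "u \<in> pverts G" "v \<in> pverts G" "a = f u" "b = f v" by blast
    then show "(a, b) \<in> map_prod f f ` parcs G" using arc ab by force
  qed
  moreover have "map_prod f f ` parcs G \<subseteq> parcs H"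
    using arc sub by auto
  ultimately have aH: "map_prod f f ` parcs G = parcs H" by blast
  have "pre_digraph.digraph_isomorphism (with_proj G) h"
    using inj inj2 G.wf_digraph by (simp add: pre_digraph.digraph_isomorphism_def h_def)
  moreover have "with_proj H = app_iso h (with_proj G)"
    using img aH by (simp add: app_iso_def h_def with_proj_def)
  ultimately show "digraph_iso (with_proj G) (with_proj H)"
    unfolding digraph_iso_def by blast
qed

end

(* In a finite cyclic group there is exactly one subgroup of each order dividing the group order,
   and these subgroups are ordered by inclusion as their orders are by divisibility.  Hence
   sending the class of x to the order of x is an isomorphism from R(G) to D(n). *)
theory Submission
  imports Defs "HOL-Number_Theory.Cong"
begin

text \<open>Writing x = y^k gives x^(ord y) = 1. If y has infinite order, \<open>ord y\<close> is 0
  and the claim still holds.\<close>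

lemma (in group) generate_subset_imp_ord_dvd:
  assumes "x \<in> carrier G" "y \<in> carrier G" "generate G {x} \<subseteq> generate G {y}"
  shows "ord x dvd ord y"
proof -
  have "x \<in> generate G {y}"
    using assms by (simp add: generate_singleton_mono_iff)
  then obtain k :: int where "x = y [^] k"
    using generate_pow[OF assms(2)] by blast
  then have "x [^] int (ord y) = y [^] (k * int (ord y))"
    using assms(2) by (simp add: int_pow_pow)
  also have "\<dots> = \<one>"
    using assms(2) by (simp only: int_pow_eq_id dvd_triv_right)
  finally show ?thesis
    using assms(1) by (simp add: int_pow_int pow_eq_id)
qed

text \<open>With N = \<open>ord g\<close>, the order of g^b is N / gcd(b, N), so the hypothesis
  forces gcd(b, N) to divide a. This makes b m = a (mod N) solvable, and a solution m gives g^a =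
  (g^b)^m.\<close>

lemma (in group) pow_in_generate_pow_if_ord_dvd:
  assumes g: "g \<in> carrier G" and pos: "0 < ord g"
    and dvd: "ord (g [^] a) dvd ord (g [^] b)"
  shows "g [^] (a::nat) \<in> generate G {g [^] (b::nat)}"
proof -
  have "g [^] (a * ord (g [^] b)) = \<one>"
    using g dvd by (simp add: nat_pow_pow[symmetric] pow_eq_id)
  then have *: "ord g dvd a * ord (g [^] b)"
    using g by (simp add: pow_eq_id)
  \<comment> \<open>The order formula in product form; it also covers b = 0, where the gcd is
    \<open>ord g\<close> and the order is 1.\<close>
  have ordb: "ord (g [^] b) * gcd b (ord g) = ord g"
    using g pos by (auto simp: ord_pow_gen gcd.commute)
  then have "gcd b (ord g) * ord (g [^] b) dvd a * ord (g [^] b)"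
    using * by (simp add: mult.commute)
  moreover have "ord (g [^] b) \<noteq> 0"
    using ordb pos by (metis mult_0 less_irrefl)
  ultimately have "gcd b (ord g) dvd a" by simp
  then obtain m where "[b * m = a] (mod ord g)"
    using cong_solve_dvd_nat by blast
  \<comment> \<open>The difference is taken in the integers, since subtraction of naturals
    truncates.\<close>
  then have "int (ord g) dvd int a - int (b * m)"
    by (metis cong_iff_dvd_diff cong_int_iff cong_sym)
  then have "g [^] int (b * m) = g [^] int a"
    using g by (simp only: int_pow_eq)
  then have "g [^] a = (g [^] b) [^] int m"
    using g by (simp add: int_pow_int nat_pow_pow del: of_nat_mult)
  then show ?thesis
    using g generate_pow[of "g [^] b"] by auto
qed

text \<open>For the direction from orders to subgroups, both elements are written as powers of one
  generator. It fails in the Klein four-group, whose involutions generate different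
  subgroups.\<close>

lemma (in group) cyclic_group_generate_subset_iff_ord_dvd:
  assumes cyc: "cyclic_group G" and fin: "finite (carrier G)"
    and x: "x \<in> carrier G" and y: "y \<in> carrier G"
  shows "generate G {x} \<subseteq> generate G {y} \<longleftrightarrow> ord x dvd ord y"
proof
  assume "ord x dvd ord y"
  obtain g where g: "g \<in> carrier G" and "subgroup_generated G {g} = G"
    using cyc unfolding cyclic_group_def by blast
  then have "carrier G = generate G {g}"
    using carrier_subgroup_generated_by_singleton[OF g] by (simp add: generate_pow full_SetCompr_eq)
  then have "\<exists>a::nat. z = g [^] a" if "z \<in> carrier G" for z
    using that generate_singleton_eq_pow[OF fin g, of z] by blast
  then obtain a b :: nat where "x = g [^] a" "y = g [^] b"
    using x y by blast
  then have "x \<in> generate G {y}"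
    using pow_in_generate_pow_if_ord_dvd[OF g] \<open>ord x dvd ord y\<close> ord_ge_1[OF fin g] by simp
  then show "generate G {x} \<subseteq> generate G {y}"
    using x y by (simp add: generate_singleton_mono_iff)
qed (use x y in \<open>rule generate_subset_imp_ord_dvd\<close>)

lemma (in group) cyclic_group_ex_ord:
  assumes cyc: "cyclic_group G" and fin: "finite (carrier G)" and d: "d dvd order G"
  shows "\<exists>x\<in>carrier G. ord x = d"
proof -
  obtain g where g: "g \<in> carrier G" and sub: "subgroup_generated G {g} = G"
    using cyc unfolding cyclic_group_def by blast
  have ord: "ord g = order G"
    using cyclic_order_is_ord[OF g] sub by simp
  have pos: "0 < order G"
    using fin by (simp add: order_gt_0_iff_finite)
  obtain k where k: "order G = d * k"
    using d by blast
  \<comment> \<open>The witness is g^(n/d) for a generator g and n = \<open>order G\<close>; k is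
    nonzero because n is positive.\<close>
  then have "ord (g [^] k) = d"
    using ord_pow[OF g, of k] pos ord by simp
  then show ?thesis
    using g by blast
qed

theorem mainTheorem6:
  fixes G :: "('a, 'b) monoid_scheme" and n :: nat
  assumes "0 < n"
    and "group G"
    and "cyclic_group G"
    and "order G = n"
  shows "digraph_iso (with_proj (reduced_power_graph G)) (with_proj (divisor_graph n))"
proof -
  interpret group G by (rule assms(2))
  have fin: "finite (carrier G)"
    using assms(1,4) order_gt_0_iff_finite by simp
  let ?cl = "\<lambda>x. same_generated G `` {x}"
  \<comment> \<open>The choice of representative is harmless: \<open>ord x\<close> is the size of
    the subgroup generated by x, hence constant on each class.\<close>
  define f where "f A = ord (SOME x. x \<in> A)" for A
  note sub = cyclic_group_generate_subset_iff_ord_dvd[OF assms(3) fin]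
  \<comment> \<open>Two inclusions of subgroups become two divisibilities, and divisibility on
    naturals is antisymmetric. This yields injectivity of \<open>f\<close>.\<close>
  have cl_eq: "?cl x = ?cl y \<longleftrightarrow> ord x = ord y" if "x \<in> carrier G" "y \<in> carrier G" for x y
  proof -
    have "?cl x = ?cl y \<longleftrightarrow> generate G {x} = generate G {y}"
      using that by (simp only: eq_equiv_class_iff[OF equiv_same_generated])
        (simp add: same_generated_def)
    then show ?thesis
      using sub[of x y] sub[of y x] that by auto
  qed
  have f_cl: "f (?cl x) = ord x" if x: "x \<in> carrier G" for x
  proof -
    have "(SOME z. z \<in> ?cl x) \<in> ?cl x"
      by (rule someI[of _ x]) (use x in \<open>simp add: same_generated_def\<close>)
    then show ?thesis
      using generate_pow_card x by (simp add: f_def same_generated_def)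
  qed
  have verts: "pverts (reduced_power_graph G) = ?cl ` carrier G"
    by (auto simp: reduced_power_graph_def quotient_def)
  have ord_vert: "ord x \<in> pverts (divisor_graph n)" if "x \<in> carrier G" for x
    using that ord_ge_1[OF fin that] ord_dvd_group_order assms(4) by (simp add: divisor_graph_def)
  have "inj_on f (?cl ` carrier G)"
    by (auto simp: inj_on_def f_cl cl_eq)
  moreover have "f ` ?cl ` carrier G = pverts (divisor_graph n)"
  proof
    show "f ` ?cl ` carrier G \<subseteq> pverts (divisor_graph n)"
      using f_cl ord_vert by auto
    show "pverts (divisor_graph n) \<subseteq> f ` ?cl ` carrier G"
    proof
      fix d assume "d \<in> pverts (divisor_graph n)"
      then obtain x where "x \<in> carrier G" "ord x = d"
        using cyclic_group_ex_ord[OF assms(3) fin] assms(4) by (auto simp: divisor_graph_def)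
      then show "d \<in> f ` ?cl ` carrier G"
        using f_cl[of x] by (metis imageI)
    qed
  qed
  ultimately have bij: "bij_betw f (pverts (reduced_power_graph G)) (pverts (divisor_graph n))"
    by (simp add: bij_betw_def verts)
  have arc: "(?cl x, ?cl y) \<in> parcs (reduced_power_graph G) \<longleftrightarrow>
      (f (?cl x), f (?cl y)) \<in> parcs (divisor_graph n)"
    if x: "x \<in> carrier G" and y: "y \<in> carrier G" for x y
  proof (cases "?cl x = ?cl y")
    case True
    \<comment> \<open>Neither graph has loops, so both sides are false.\<close>
    then show ?thesis
      by (simp add: reduced_power_graph_def divisor_graph_def)
  next
    case False
    then have ne: "ord x \<noteq> ord y" "x \<noteq> y"
      using cl_eq x y by auto
    have "(?cl x, ?cl y) \<in> parcs (reduced_power_graph G) \<longleftrightarrow> (x, y) \<in> parcs (power_graph G)"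
      by (rule reduced_power_graph_arc_iff[OF fin x y False])
    also have "\<dots> \<longleftrightarrow> (\<exists>m::nat. 0 < m \<and> x = y [^]\<^bsub>G\<^esub> m) \<or> (\<exists>m::nat. 0 < m \<and> y = x [^]\<^bsub>G\<^esub> m)"
      using x y ne by (auto simp: power_graph_def)
    \<comment> \<open>Being a positive power of y means lying in the subgroup generated by y, so
      adjacency says that the two subgroups are nested.\<close>
    also have "\<dots> \<longleftrightarrow> ord x dvd ord y \<or> ord y dvd ord x"
      using x y sub
      by (simp only: generate_singleton_eq_pow[OF fin, symmetric] generate_singleton_mono_iff)
    also have "\<dots> \<longleftrightarrow> (ord x, ord y) \<in> parcs (divisor_graph n)"
      using ord_vert[OF x] ord_vert[OF y] ne by (simp add: divisor_graph_def)
    finally show ?thesis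
      using x y by (simp add: f_cl)
  qed
  have "pair_wf_digraph (reduced_power_graph G)" "pair_wf_digraph (divisor_graph n)"
    by (auto simp: pair_wf_digraph_def reduced_power_graph_def divisor_graph_def)
  then show ?thesis
    using bij arc by (subst digraph_iso_with_proj_iff) (auto simp: verts)
qed

end
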